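(* Let $R$ be a ring and $\alpha$ an endomorphism of $R$. Then the following conditions are equivalent: (i) the skew power series ring $R[[x;\alpha]]$ is a reduced right Archimedean ring; (ii) $R$ is a right Archimedean ring, $\alpha$ is rigid and $\alpha$ preserves nonunits of $R$; (iii) $R$ is a reduced right Archimedean ring, $\alpha$ is compatible and $\alpha$ preserves nonunits of $R$.
   Context: Rings are associative with unity, not necessarily commutative; endomorphisms are (unital) ring endomorphisms. $U(A)$ denotes the group of units (two-sided invertible elements) of a ring $A$; elements of $A\setminus U(A)$ are called nonunits. $\mathbb{N}$ is the set of positive integers. A ring $A$ is right Archimedean if $\bigcap_{n\in\mathbb{N}} Aa^n = 0$ for every $a\in A\setminus U(A)$. A ring is reduced if it has no nonzero nilpotent elements. The skew power series ring $R[[x;\alpha]]$ consists of power series over $R$ in the variable $x$ with coefficients written on the left of powers of $x$, with term-wise addition and with multiplication subject to the relation $xa=\alpha(a)x$ for $a\in R$. An endomorphism $\alpha$ of $R$ is rigid if, for any $a\in R$, $a\alpha(a)=0$ implies $a=0$. It is compatible if for any $a,b\in R$ we have $ab=0$ if and only if $a\alpha(b)=0$. It preserves nonunits of $R$ if $\alpha(R\setminus U(R))\subseteq R\setminus U(R)$. *)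

theory Defs
  imports "HOL-Algebra.QuotRing"
begin

text \<open>
  Rings are HOL-Algebra rings: associative with unity, not necessarily commutative;
  the zero ring is not excluded.
\<close>

locale reduced_ring = ring R for R (structure) +
  assumes nilpotent_imp_zero:
    "\<lbrakk>a \<in> carrier R; 0 < (n::nat); a [^] n = \<zero>\<rbrakk> \<Longrightarrow> a = \<zero>"

text \<open>
  The coset \<open>carrier R #> b\<close> is taken in the multiplicative monoid of \<open>R\<close>, so it is the
  principal left ideal \<open>Rb\<close>. The exponents are positive.
\<close>

locale right_archimedean_ring = ring R for R (structure) +
  assumes Inter_left_ideals_power:
    "a \<in> carrier R - Units R \<Longrightarrow> (\<Inter>n\<in>{1::nat..}. carrier R #> (a [^] n)) = {\<zero>}"

text \<open>
  The series with coefficients \<open>f 0, f 1, \<dots>\<close>, written on the left of the powers of \<open>x\<close>, is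
  the function \<open>f\<close>. The relation \<open>x a = \<alpha>(a) x\<close> gives
  \<open>(a x\<^sup>i) (b x\<^sup>j) = a \<alpha>\<^sup>i(b) x\<^sup>i\<^sup>+\<^sup>j\<close>, whence the coefficients of a product.
\<close>

definition skew_power_series ::
    "('a, 'm) ring_scheme \<Rightarrow> ('a \<Rightarrow> 'a) \<Rightarrow> (nat \<Rightarrow> 'a) ring"
  where
  "skew_power_series R \<alpha> =
    \<lparr>carrier = {f. \<forall>n. f n \<in> carrier R},
     mult = (\<lambda>f g n. \<Oplus>\<^bsub>R\<^esub>i\<in>{..n}. f i \<otimes>\<^bsub>R\<^esub> (\<alpha> ^^ i) (g (n - i))),
     one = (\<lambda>n. if n = 0 then \<one>\<^bsub>R\<^esub> else \<zero>\<^bsub>R\<^esub>),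
     zero = (\<lambda>n. \<zero>\<^bsub>R\<^esub>),
     add = (\<lambda>f g n. f n \<oplus>\<^bsub>R\<^esub> g n)\<rparr>"

definition rigid :: "('a, 'm) ring_scheme \<Rightarrow> ('a \<Rightarrow> 'a) \<Rightarrow> bool"
  where
  "rigid R \<alpha> \<longleftrightarrow> (\<forall>a\<in>carrier R. a \<otimes>\<^bsub>R\<^esub> \<alpha> a = \<zero>\<^bsub>R\<^esub> \<longrightarrow> a = \<zero>\<^bsub>R\<^esub>)"

definition compatible :: "('a, 'm) ring_scheme \<Rightarrow> ('a \<Rightarrow> 'a) \<Rightarrow> bool"
  where
  "compatible R \<alpha> \<longleftrightarrow>
    (\<forall>a\<in>carrier R. \<forall>b\<in>carrier R. a \<otimes>\<^bsub>R\<^esub> b = \<zero>\<^bsub>R\<^esub> \<longleftrightarrow> a \<otimes>\<^bsub>R\<^esub> \<alpha> b = \<zero>\<^bsub>R\<^esub>)"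

definition preserves_nonunits :: "('a, 'm) ring_scheme \<Rightarrow> ('a \<Rightarrow> 'a) \<Rightarrow> bool"
  where
  "preserves_nonunits R \<alpha> \<longleftrightarrow>
    \<alpha> ` (carrier R - Units R) \<subseteq> carrier R - Units R"

end

theory Submission
  imports Defs "HOL-Algebra.UnivPoly"
begin

text \<open>Write S for the skew power series ring. Conditions (ii) and (iii) agree because rigidity
  amounts to reducedness together with compatibility (\<open>rigid_iff\<close>). In a reduced ring a
  vanishing product of two elements stays zero when they are swapped or a factor is inserted between
  them; compatibility lets powers of \<alpha> be put on or taken off the right factor.

  From S to R, three series suffice: the square of \<open>a x\<close> is
  \<open>a \<alpha>(a) x^2\<close>, which gives rigidity; constant series carry the Archimedean
  property down; and if \<alpha>(a) were a unit for a nonunit a, then x would lie in every S a^n.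

  From R to S, reducedness follows by looking at lowest coefficients
  (\<open>series_reduced\<close>). For the Archimedean property, a nonunit f has a nonunit constant
  term a (\<open>series_Units_iff\<close>). Let g lie in every S f^n, say g = h f^n. By induction on
  k every coefficient h_k annihilates a: \<open>mult_coeff_mult_endo\<close> places g_k
  \<alpha>^k(a), which does not depend on n, in every left ideal generated by a power of the nonunit
  \<alpha>^k(a), so it is zero. Coefficients of f^n below degree n are then annihilated as well
  (\<open>annihilates_low_coeffs_pow\<close>), and n > k yields g_k = 0.\<close>

section \<open>Finite sums: isolating a term and reindexing a triangle\<close>

lemma (in abelian_monoid) finsum_eq_single:
  assumes "finite A" "i \<in> A" "f i \<in> carrier G" "\<And>j. j \<in> A \<Longrightarrow> j \<noteq> i \<Longrightarrow> f j = \<zero>"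
  shows "finsum G f A = f i"
proof -
  have "finsum G f A = (\<Oplus>j\<in>A. if i = j then f i else \<zero>)"
    using assms by (intro finsum_cong') auto
  also have "\<dots> = f i"
    using assms by (intro finsum_singleton[where f = "\<lambda>_. f i"]) auto
  finally show ?thesis .
qed

text \<open>Both sides run over the triangle i \<le> k \<le> n, once by k and once by i with j = k -
  i. Associativity of the convolution product rests on this exchange.\<close>

lemma (in abelian_monoid) finsum_triangle:
  fixes G' :: "nat \<Rightarrow> nat \<Rightarrow> 'a"
  assumes G: "\<And>i k. G' i k \<in> carrier G"
  shows "(\<Oplus>k\<in>{..n}. \<Oplus>i\<in>{..k}. G' i k) = (\<Oplus>i\<in>{..n}. \<Oplus>j\<in>{..n - i}. G' i (i + j))"
proof (induction n)
  case 0
  then show ?case using G by simp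
next
  case (Suc n)
  have "(\<Oplus>i\<in>{..n}. \<Oplus>j\<in>{..Suc n - i}. G' i (i + j))
      = (\<Oplus>i\<in>{..n}. (\<Oplus>j\<in>{..n - i}. G' i (i + j)) \<oplus> G' i (Suc n))"
    using G by (intro finsum_cong') (auto simp: Suc_diff_le a_comm)
  also have "\<dots> = (\<Oplus>i\<in>{..n}. \<Oplus>j\<in>{..n - i}. G' i (i + j)) \<oplus> (\<Oplus>i\<in>{..n}. G' i (Suc n))"
    using G by (intro finsum_addf) auto
  finally show ?case
    using G Suc.IH by (simp add: Pi_def a_ac)
qed

section \<open>Elementwise criteria for reduced and right Archimedean rings\<close>

text \<open>Squares suffice by descent: if a^n = 0 with n > 1, half of n rounded up is a smaller
  exponent m for which the square of a^m is zero.\<close>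

lemma reduced_ringI:
  assumes "ring R"
    and square: "\<And>a. a \<in> carrier R \<Longrightarrow> a \<otimes>\<^bsub>R\<^esub> a = \<zero>\<^bsub>R\<^esub> \<Longrightarrow> a = \<zero>\<^bsub>R\<^esub>"
  shows "reduced_ring R"
proof -
  interpret ring R by fact
  show ?thesis
  proof
    fix a and n :: nat
    assume a: "a \<in> carrier R"
    show "0 < n \<Longrightarrow> a [^]\<^bsub>R\<^esub> n = \<zero>\<^bsub>R\<^esub> \<Longrightarrow> a = \<zero>\<^bsub>R\<^esub>"
    proof (induction n rule: less_induct)
      case (less n)
      show ?case
      proof (cases "n = 1")
        case True
        then show ?thesis using less.prems a by simp
      next
        case False
        define m where "m = (n + 1) div 2"
        \<comment> \<open>The excess \<open>d\<close> is 0 or 1 according to the parity of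
          \<open>n\<close>.\<close>
        define d where "d = m + m - n"
        have m: "m < n" "0 < m" "m + m = n + d"
          using False less.prems by (auto simp: m_def d_def)
        have "a [^]\<^bsub>R\<^esub> m \<otimes>\<^bsub>R\<^esub> a [^]\<^bsub>R\<^esub> m = a [^]\<^bsub>R\<^esub> n \<otimes>\<^bsub>R\<^esub> a [^]\<^bsub>R\<^esub> d"
          by (simp only: nat_pow_mult a m(3))
        then have "a [^]\<^bsub>R\<^esub> m = \<zero>\<^bsub>R\<^esub>"
          using a less.prems by (subst square[OF nat_pow_closed]) simp_all
        then show ?thesis using less.IH m by blast
      qed
    qed
  qed
qed

context reduced_ring
begin

lemma square_zeroD: "a \<in> carrier R \<Longrightarrow> a \<otimes> a = \<zero> \<Longrightarrow> a = \<zero>"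
  using nilpotent_imp_zero[of a 2] by (simp add: numeral_2_eq_2)

text \<open>The square of ba contains the factor ab.\<close>

lemma mult_zero_swap:
  assumes "a \<in> carrier R" "b \<in> carrier R" "a \<otimes> b = \<zero>"
  shows "b \<otimes> a = \<zero>"
proof (rule square_zeroD)
  have "b \<otimes> a \<otimes> (b \<otimes> a) = b \<otimes> (a \<otimes> b) \<otimes> a"
    using assms(1,2) by (simp add: m_assoc)
  then show "b \<otimes> a \<otimes> (b \<otimes> a) = \<zero>" using assms by simp
qed (use assms in auto)

text \<open>The square of acb contains the factor ba, which vanishes by
  \<open>mult_zero_swap\<close>.\<close>

lemma mult_zero_insert:
  assumes "a \<in> carrier R" "b \<in> carrier R" "c \<in> carrier R" "a \<otimes> b = \<zero>"
  shows "a \<otimes> c \<otimes> b = \<zero>"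
proof (rule square_zeroD)
  have "a \<otimes> c \<otimes> b \<otimes> (a \<otimes> c \<otimes> b) = a \<otimes> c \<otimes> (b \<otimes> a) \<otimes> (c \<otimes> b)"
    using assms(1,2,3) by (simp add: m_assoc)
  then show "a \<otimes> c \<otimes> b \<otimes> (a \<otimes> c \<otimes> b) = \<zero>"
    using assms mult_zero_swap[of a b] by simp
qed (use assms in auto)

lemma mult_pow_zeroD:
  assumes "a \<in> carrier R" "b \<in> carrier R"
  shows "a \<otimes> b [^] Suc n = \<zero> \<Longrightarrow> a \<otimes> b = \<zero>"
proof (induction n)
  case 0
  then show ?case using assms by simp
next
  case (Suc n)
  define c d where "c = a \<otimes> b [^] Suc n" and "d = a \<otimes> b [^] n"
  have cd: "c \<in> carrier R" "d \<in> carrier R" "c = d \<otimes> b"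
    using assms by (simp_all add: c_def d_def m_assoc)
  have "c \<otimes> b = \<zero>"
    using Suc.prems assms unfolding c_def by (simp add: m_assoc)
  \<comment> \<open>Inserting \<open>d\<close> turns the product into the square of
    \<open>c\<close>, so one factor \<open>b\<close> can be stripped.\<close>
  then have "c \<otimes> d \<otimes> b = \<zero>"
    using mult_zero_insert cd assms by blast
  then have "c \<otimes> (d \<otimes> b) = \<zero>"
    using cd(1,2) assms by (simp add: m_assoc)
  then have "c = \<zero>"
    using cd square_zeroD by metis
  then show ?case using Suc.IH by (simp add: c_def)
qed

end

text \<open>Replaces the intersection of cosets by divisibility by all powers. Since zero is always
  divisible, only one inclusion has content.\<close>

lemma right_archimedean_ring_iff:
  assumes "ring R"
  shows "right_archimedean_ring R \<longleftrightarrow>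
    (\<forall>a\<in>carrier R - Units R. \<forall>b\<in>carrier R.
      (\<forall>n\<ge>1. \<exists>c\<in>carrier R. b = c \<otimes>\<^bsub>R\<^esub> a [^]\<^bsub>R\<^esub> (n::nat)) \<longrightarrow> b = \<zero>\<^bsub>R\<^esub>)"
  (is "_ \<longleftrightarrow> ?rhs")
proof -
  interpret ring R by fact
  have mem: "b \<in> (\<Inter>n\<in>{1::nat..}. carrier R #>\<^bsub>R\<^esub> (a [^]\<^bsub>R\<^esub> n)) \<longleftrightarrow>
      b \<in> carrier R \<and> (\<forall>n\<ge>1. \<exists>c\<in>carrier R. b = c \<otimes>\<^bsub>R\<^esub> a [^]\<^bsub>R\<^esub> (n::nat))"
    if "a \<in> carrier R" for a b
  proof
    assume "b \<in> (\<Inter>n\<in>{1::nat..}. carrier R #>\<^bsub>R\<^esub> (a [^]\<^bsub>R\<^esub> n))"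
    then have b: "\<exists>c\<in>carrier R. b = c \<otimes>\<^bsub>R\<^esub> a [^]\<^bsub>R\<^esub> n" if "n \<ge> 1" for n :: nat
      using that by (auto simp: r_coset_def)
    then have "b \<in> carrier R"
      using \<open>a \<in> carrier R\<close> b[of 1] by auto
    then show "b \<in> carrier R \<and> (\<forall>n\<ge>1. \<exists>c\<in>carrier R. b = c \<otimes>\<^bsub>R\<^esub> a [^]\<^bsub>R\<^esub> (n::nat))"
      using b by blast
  qed (auto simp: r_coset_def)
  have zero: "\<exists>c\<in>carrier R. \<zero>\<^bsub>R\<^esub> = c \<otimes>\<^bsub>R\<^esub> a [^]\<^bsub>R\<^esub> (n::nat)" if "a \<in> carrier R" for a n
    using that by (intro bexI[of _ "\<zero>\<^bsub>R\<^esub>"]) auto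
  have "right_archimedean_ring R \<longleftrightarrow>
      (\<forall>a\<in>carrier R - Units R. (\<Inter>n\<in>{1::nat..}. carrier R #>\<^bsub>R\<^esub> (a [^]\<^bsub>R\<^esub> n)) = {\<zero>\<^bsub>R\<^esub>})"
    using assms by (simp add: right_archimedean_ring_def right_archimedean_ring_axioms_def Ball_def)
  also have "\<dots> \<longleftrightarrow> ?rhs"
  proof (rule ball_cong[OF refl])
    fix a assume "a \<in> carrier R - Units R"
    then have a: "a \<in> carrier R" by simp
    show "(\<Inter>n\<in>{1::nat..}. carrier R #>\<^bsub>R\<^esub> (a [^]\<^bsub>R\<^esub> n)) = {\<zero>\<^bsub>R\<^esub>} \<longleftrightarrow>
      (\<forall>b\<in>carrier R. (\<forall>n\<ge>1. \<exists>c\<in>carrier R. b = c \<otimes>\<^bsub>R\<^esub> a [^]\<^bsub>R\<^esub> (n::nat)) \<longrightarrow> b = \<zero>\<^bsub>R\<^esub>)"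
      unfolding set_eq_iff mem[OF a] using zero[OF a] by blast
  qed
  finally show ?thesis .
qed

section \<open>The skew power series ring\<close>

locale skew_ring = ring R for R (structure) +
  fixes \<alpha> :: "'a \<Rightarrow> 'a"
  assumes hom: "\<alpha> \<in> ring_hom R R"
begin

abbreviation S where "S \<equiv> skew_power_series R \<alpha>"

lemma endo_ring_hom_ring: "ring_hom_ring R R (\<alpha> ^^ i)"
proof -
  have "\<alpha> ^^ i \<in> ring_hom R R"
    by (induction i) (use hom in \<open>auto simp: ring_hom_def Pi_def\<close>)
  then show ?thesis
    by unfold_locales auto
qed

lemma endo_closed [simp]: "a \<in> carrier R \<Longrightarrow> (\<alpha> ^^ i) a \<in> carrier R"
  by (rule ring_hom_ring.homh[OF endo_ring_hom_ring, THEN ring_hom_closed])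

lemma endo_one [simp]: "(\<alpha> ^^ i) \<one> = \<one>"
  by (rule ring_hom_ring.homh[OF endo_ring_hom_ring, THEN ring_hom_one])

lemma endo_zero [simp]: "(\<alpha> ^^ i) \<zero> = \<zero>"
  using ring_hom_zero[OF ring_hom_ring.homh[OF endo_ring_hom_ring]] ring_axioms by blast

lemma endo_add:
  "\<lbrakk>a \<in> carrier R; b \<in> carrier R\<rbrakk> \<Longrightarrow> (\<alpha> ^^ i) (a \<oplus> b) = (\<alpha> ^^ i) a \<oplus> (\<alpha> ^^ i) b"
  by (rule ring_hom_ring.homh[OF endo_ring_hom_ring, THEN ring_hom_add])

lemma endo_mult:
  "\<lbrakk>a \<in> carrier R; b \<in> carrier R\<rbrakk> \<Longrightarrow> (\<alpha> ^^ i) (a \<otimes> b) = (\<alpha> ^^ i) a \<otimes> (\<alpha> ^^ i) b"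
  by (rule ring_hom_ring.homh[OF endo_ring_hom_ring, THEN ring_hom_mult])

lemma endo_pow: "a \<in> carrier R \<Longrightarrow> (\<alpha> ^^ i) (a [^] (n::nat)) = (\<alpha> ^^ i) a [^] n"
  by (rule ring_hom_ring.hom_nat_pow[OF endo_ring_hom_ring])

lemma endo_endo: "(\<alpha> ^^ i) ((\<alpha> ^^ j) a) = (\<alpha> ^^ (i + j)) a"
  by (simp add: funpow_add)

lemma coeff_closed: "f \<in> carrier S \<Longrightarrow> f n \<in> carrier R"
  by (simp add: skew_power_series_def)

lemma seriesI: "(\<And>n. f n \<in> carrier R) \<Longrightarrow> f \<in> carrier S"
  by (simp add: skew_power_series_def)

lemma coeff_mult: "(f \<otimes>\<^bsub>S\<^esub> g) n = (\<Oplus>i\<in>{..n}. f i \<otimes> (\<alpha> ^^ i) (g (n - i)))"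
  by (simp add: skew_power_series_def)

lemma coeff_add: "(f \<oplus>\<^bsub>S\<^esub> g) n = f n \<oplus> g n"
  by (simp add: skew_power_series_def)

lemma coeff_one: "\<one>\<^bsub>S\<^esub> n = (if n = 0 then \<one> else \<zero>)"
  by (simp add: skew_power_series_def)

lemma coeff_zero: "\<zero>\<^bsub>S\<^esub> n = \<zero>"
  by (simp add: skew_power_series_def)

lemma series_mult_closed: "f \<in> carrier S \<Longrightarrow> g \<in> carrier S \<Longrightarrow> f \<otimes>\<^bsub>S\<^esub> g \<in> carrier S"
  by (rule seriesI) (auto simp: coeff_mult coeff_closed)

lemma series_mult_assoc:
  assumes "f \<in> carrier S" "g \<in> carrier S" "h \<in> carrier S"
  shows "f \<otimes>\<^bsub>S\<^esub> g \<otimes>\<^bsub>S\<^esub> h = f \<otimes>\<^bsub>S\<^esub> (g \<otimes>\<^bsub>S\<^esub> h)"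
proof
  note [simp] = coeff_closed[OF assms(1)] coeff_closed[OF assms(2)] coeff_closed[OF assms(3)]
  fix n
  \<comment> \<open>The common term of both bracketings: \<open>i\<close> is the degree taken from
    \<open>f\<close>, \<open>k\<close> the total degree taken from \<open>f\<close> and
    \<open>g\<close>.\<close>
  define T where "T i k = f i \<otimes> (\<alpha> ^^ i) (g (k - i)) \<otimes> (\<alpha> ^^ k) (h (n - k))" for i k
  have T: "T i k \<in> carrier R" for i k
    using assms by (simp add: T_def)
  have "(f \<otimes>\<^bsub>S\<^esub> g \<otimes>\<^bsub>S\<^esub> h) n = (\<Oplus>k\<in>{..n}. \<Oplus>i\<in>{..k}. T i k)"
    unfolding coeff_mult T_def
    using assms by (intro finsum_cong' finsum_ldistr) auto
  also have "\<dots> = (\<Oplus>i\<in>{..n}. \<Oplus>j\<in>{..n - i}. T i (i + j))"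
    using T by (rule finsum_triangle)
  also have "\<dots> = (f \<otimes>\<^bsub>S\<^esub> (g \<otimes>\<^bsub>S\<^esub> h)) n"
    unfolding coeff_mult
  proof (intro finsum_cong')
    fix i assume "i \<in> {..n}"
    have "f i \<otimes> (\<alpha> ^^ i) (\<Oplus>j\<in>{..n - i}. g j \<otimes> (\<alpha> ^^ j) (h (n - i - j)))
        = f i \<otimes> (\<Oplus>j\<in>{..n - i}. (\<alpha> ^^ i) (g j \<otimes> (\<alpha> ^^ j) (h (n - i - j))))"
      using assms by (subst ring_hom_ring.hom_finsum[OF endo_ring_hom_ring]) (auto simp: comp_def)
    also have "\<dots> = (\<Oplus>j\<in>{..n - i}. f i \<otimes> (\<alpha> ^^ i) (g j \<otimes> (\<alpha> ^^ j) (h (n - i - j))))"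
      using assms by (intro finsum_rdistr) auto
    also have "\<dots> = (\<Oplus>j\<in>{..n - i}. T i (i + j))"
      unfolding T_def
      using assms by (intro finsum_cong') (auto simp: endo_mult endo_endo m_assoc)
    finally show "(\<Oplus>j\<in>{..n - i}. T i (i + j))
        = f i \<otimes> (\<alpha> ^^ i) (\<Oplus>j\<in>{..n - i}. g j \<otimes> (\<alpha> ^^ j) (h (n - i - j)))" by simp
  qed (use assms in auto)
  finally show "(f \<otimes>\<^bsub>S\<^esub> g \<otimes>\<^bsub>S\<^esub> h) n = (f \<otimes>\<^bsub>S\<^esub> (g \<otimes>\<^bsub>S\<^esub> h)) n" .
qed

text \<open>This is \<open>a x^k\<close>: exponent 0 embeds the coefficient ring, and
  \<open>monom \<one> 1\<close> is the variable.\<close>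

definition monom :: "'a \<Rightarrow> nat \<Rightarrow> nat \<Rightarrow> 'a"
  where "monom a k = (\<lambda>n. if n = k then a else \<zero>)"

lemma monom_closed [simp]: "a \<in> carrier R \<Longrightarrow> monom a k \<in> carrier S"
  by (rule seriesI) (simp add: monom_def)

lemma coeff_monom_mult:
  assumes "a \<in> carrier R" "f \<in> carrier S"
  shows "(monom a k \<otimes>\<^bsub>S\<^esub> f) n = (if k \<le> n then a \<otimes> (\<alpha> ^^ k) (f (n - k)) else \<zero>)"
proof (cases "k \<le> n")
  case True
  then have "(monom a k \<otimes>\<^bsub>S\<^esub> f) n = monom a k k \<otimes> (\<alpha> ^^ k) (f (n - k))"
    unfolding coeff_mult using assms coeff_closed[OF assms(2)]
    by (intro finsum_eq_single) (auto simp: monom_def)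
  then show ?thesis using True by (simp add: monom_def)
next
  case False
  then have "(monom a k \<otimes>\<^bsub>S\<^esub> f) n = (\<Oplus>i\<in>{..n}. \<zero>)"
    unfolding coeff_mult using assms coeff_closed[OF assms(2)]
    by (intro finsum_cong') (auto simp: monom_def)
  then show ?thesis using False by simp
qed

text \<open>Contains the relation \<open>x b = \<alpha>(b) x\<close>, through which the three series
  used for the descent to R are computed.\<close>

lemma monom_mult_monom:
  assumes "a \<in> carrier R" "b \<in> carrier R"
  shows "monom a i \<otimes>\<^bsub>S\<^esub> monom b j = monom (a \<otimes> (\<alpha> ^^ i) b) (i + j)"
  using assms by (auto simp: fun_eq_iff coeff_monom_mult) (auto simp: monom_def)

lemma one_eq_monom: "\<one>\<^bsub>S\<^esub> = monom \<one> 0"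
  by (simp add: fun_eq_iff coeff_one monom_def)

lemma zero_eq_monom: "\<zero>\<^bsub>S\<^esub> = monom \<zero> k"
  by (simp add: fun_eq_iff coeff_zero monom_def)

lemma monom_eq_iff [simp]: "monom a k = monom b k \<longleftrightarrow> a = b"
  by (auto simp: monom_def fun_eq_iff)

lemma ring_series: "ring S"
proof (intro ringI abelian_groupI monoidI)
  fix f assume f: "f \<in> carrier S"
  note [simp] = coeff_closed[OF f]
  show "\<one>\<^bsub>S\<^esub> \<otimes>\<^bsub>S\<^esub> f = f"
    using f by (simp add: fun_eq_iff one_eq_monom coeff_monom_mult)
  show "f \<otimes>\<^bsub>S\<^esub> \<one>\<^bsub>S\<^esub> = f"
  proof
    fix n
    have "(f \<otimes>\<^bsub>S\<^esub> \<one>\<^bsub>S\<^esub>) n = f n \<otimes> (\<alpha> ^^ n) (\<one>\<^bsub>S\<^esub> (n - n))"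
      unfolding coeff_mult using f by (intro finsum_eq_single) (auto simp: coeff_one)
    then show "(f \<otimes>\<^bsub>S\<^esub> \<one>\<^bsub>S\<^esub>) n = f n" using f by (simp add: coeff_one)
  qed
  show "\<exists>g\<in>carrier S. g \<oplus>\<^bsub>S\<^esub> f = \<zero>\<^bsub>S\<^esub>"
    using f by (intro bexI[of _ "\<lambda>n. \<ominus> f n"] seriesI)
      (auto simp: fun_eq_iff coeff_add coeff_zero l_neg)
  fix g assume g: "g \<in> carrier S"
  note [simp] = coeff_closed[OF g]
  show "f \<oplus>\<^bsub>S\<^esub> g = g \<oplus>\<^bsub>S\<^esub> f"
    using f g by (simp add: fun_eq_iff coeff_add a_comm)
  fix h assume h: "h \<in> carrier S"
  note [simp] = coeff_closed[OF h]
  show "(f \<oplus>\<^bsub>S\<^esub> g) \<otimes>\<^bsub>S\<^esub> h = f \<otimes>\<^bsub>S\<^esub> h \<oplus>\<^bsub>S\<^esub> g \<otimes>\<^bsub>S\<^esub> h"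
  proof
    fix n
    show "((f \<oplus>\<^bsub>S\<^esub> g) \<otimes>\<^bsub>S\<^esub> h) n = (f \<otimes>\<^bsub>S\<^esub> h \<oplus>\<^bsub>S\<^esub> g \<otimes>\<^bsub>S\<^esub> h) n"
      using f g h unfolding coeff_mult coeff_add
      by (subst finsum_addf[symmetric]) (auto simp: l_distr intro!: finsum_cong')
  qed
  show "h \<otimes>\<^bsub>S\<^esub> (f \<oplus>\<^bsub>S\<^esub> g) = h \<otimes>\<^bsub>S\<^esub> f \<oplus>\<^bsub>S\<^esub> h \<otimes>\<^bsub>S\<^esub> g"
  proof
    fix n
    show "(h \<otimes>\<^bsub>S\<^esub> (f \<oplus>\<^bsub>S\<^esub> g)) n = (h \<otimes>\<^bsub>S\<^esub> f \<oplus>\<^bsub>S\<^esub> h \<otimes>\<^bsub>S\<^esub> g) n"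
      using f g h unfolding coeff_mult coeff_add
      by (subst finsum_addf[symmetric]) (auto simp: r_distr endo_add intro!: finsum_cong')
  qed
  show "f \<oplus>\<^bsub>S\<^esub> g \<oplus>\<^bsub>S\<^esub> h = f \<oplus>\<^bsub>S\<^esub> (g \<oplus>\<^bsub>S\<^esub> h)"
    using f g h by (simp add: fun_eq_iff coeff_add a_assoc)
qed (auto simp: fun_eq_iff coeff_add coeff_zero series_mult_closed series_mult_assoc
    coeff_one coeff_closed intro!: seriesI)

sublocale S: ring S
  by (rule ring_series)

lemma coeff_0_pow: "f \<in> carrier S \<Longrightarrow> (f [^]\<^bsub>S\<^esub> (n::nat)) 0 = f 0 [^] n"
  by (induction n) (auto simp: coeff_one coeff_mult coeff_closed)

lemma monom_0_pow: "a \<in> carrier R \<Longrightarrow> monom a 0 [^]\<^bsub>S\<^esub> (n::nat) = monom (a [^] n) 0"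
  by (induction n) (auto simp: one_eq_monom monom_mult_monom)

section \<open>Units of the series ring\<close>

text \<open>Comparing coefficients in f g = 1 determines \<open>f 0 \<otimes> g n\<close> by earlier
  coefficients of g, and \<open>f 0\<close> can be cancelled. That \<open>g 0\<close> is a unit is
  recorded so that the result applies to g in turn.\<close>

lemma series_right_inverse:
  assumes f: "f \<in> carrier S" and f0: "f 0 \<in> Units R"
  obtains g where "g \<in> carrier S" "g 0 \<in> Units R" "f \<otimes>\<^bsub>S\<^esub> g = \<one>\<^bsub>S\<^esub>"
proof -
  note [simp] = coeff_closed[OF f]
  define rest where "rest g n = (\<Oplus>i\<in>{1..n}. f i \<otimes> (\<alpha> ^^ i) (g (n - i)))" for g n
  define next_coeff where "next_coeff g n = inv (f 0) \<otimes> (\<one>\<^bsub>S\<^esub> n \<ominus> rest g n)" for g n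
  \<comment> \<open>Truncation makes it evident that the recursion at \<open>n\<close> sees only
    smaller indices, as well-founded choice demands.\<close>
  define trunc where "trunc n g = (\<lambda>m. if m < n then g m else \<zero>)" for n :: nat and g :: "nat \<Rightarrow> 'a"
  have "\<exists>g. \<forall>n. g n = next_coeff (trunc n g) n"
    by (rule dependent_wf_choice[OF wf_less]) (auto simp: trunc_def cong: if_cong)
  then obtain g where g: "\<And>n. g n = next_coeff (trunc n g) n"
    by blast
  have g_closed: "g n \<in> carrier R" for n
  proof (induction n rule: less_induct)
    case (less n)
    have "rest (trunc n g) n \<in> carrier R"
      unfolding rest_def using f less.IH by (intro finsum_closed) (auto simp: trunc_def)
    then show ?case
      using f0 by (subst g) (auto simp: next_coeff_def coeff_one)
  qed
  then have gS: "g \<in> carrier S" by (rule seriesI)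
  note [simp] = g_closed
  have rest_closed: "rest g n \<in> carrier R" for n
    unfolding rest_def using f gS by (intro finsum_closed) auto
  have g': "g n = inv (f 0) \<otimes> (\<one>\<^bsub>S\<^esub> n \<ominus> rest g n)" for n
  proof -
    \<comment> \<open>The sum starts at i = 1, so it reads only indices n - i < n and the truncation
      has no effect.\<close>
    have "rest (trunc n g) n = rest g n"
      unfolding rest_def using f gS by (intro finsum_cong') (auto simp: trunc_def)
    then show ?thesis using g[of n] by (simp add: next_coeff_def)
  qed
  have "f \<otimes>\<^bsub>S\<^esub> g = \<one>\<^bsub>S\<^esub>"
  proof
    fix n :: nat
    have "{..n} = insert 0 {1..n}" by auto
    then have "(f \<otimes>\<^bsub>S\<^esub> g) n = f 0 \<otimes> g n \<oplus> rest g n"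
      unfolding coeff_mult rest_def using f gS by (simp add: Pi_def)
    also have "f 0 \<otimes> g n = \<one>\<^bsub>S\<^esub> n \<ominus> rest g n"
      using f0 rest_closed Units_closed[OF f0]
      by (subst g') (simp add: m_assoc[symmetric] coeff_one)
    also have "\<one>\<^bsub>S\<^esub> n \<ominus> rest g n \<oplus> rest g n = \<one>\<^bsub>S\<^esub> n"
      using rest_closed by (simp add: minus_eq a_assoc l_neg coeff_one)
    finally show "(f \<otimes>\<^bsub>S\<^esub> g) n = \<one>\<^bsub>S\<^esub> n" .
  qed
  moreover have "g 0 = inv (f 0)"
    using f0 by (subst g') (simp add: rest_def coeff_one minus_eq)
  ultimately show ?thesis
    using that gS f0 by auto
qed

text \<open>Constant terms multiply as in R, which gives one direction. For the other, a right
  inverse g of f has a right inverse h of its own, and f g = g h = 1 forces f = h.\<close>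

lemma series_Units_iff:
  assumes f: "f \<in> carrier S"
  shows "f \<in> Units S \<longleftrightarrow> f 0 \<in> Units R"
proof
  assume "f \<in> Units S"
  then obtain g where g: "g \<in> carrier S" "g \<otimes>\<^bsub>S\<^esub> f = \<one>\<^bsub>S\<^esub>" "f \<otimes>\<^bsub>S\<^esub> g = \<one>\<^bsub>S\<^esub>"
    by (auto simp: Units_def)
  note [simp] = coeff_closed[OF f] coeff_closed[OF g(1)]
  have "g 0 \<otimes> f 0 = \<one>" "f 0 \<otimes> g 0 = \<one>"
    using arg_cong[OF g(2), of "\<lambda>f. f 0"] arg_cong[OF g(3), of "\<lambda>f. f 0"]
    by (simp_all add: coeff_mult coeff_one)
  then show "f 0 \<in> Units R" using f g unfolding Units_def by auto
next
  assume "f 0 \<in> Units R"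
  then obtain g where g: "g \<in> carrier S" "g 0 \<in> Units R" "f \<otimes>\<^bsub>S\<^esub> g = \<one>\<^bsub>S\<^esub>"
    using series_right_inverse[OF f] by blast
  then obtain h where h: "h \<in> carrier S" "g \<otimes>\<^bsub>S\<^esub> h = \<one>\<^bsub>S\<^esub>"
    using series_right_inverse by blast
  have "f = h" by (rule S.inv_unique[OF g(3) h(2) g(1) f h(1)])
  then show "f \<in> Units S" using f g h unfolding Units_def by auto
qed

section \<open>Rigidity and compatibility\<close>

lemmas hom_rules = ring_hom_closed[OF hom] ring_hom_mult[OF hom]

lemma endo_annihilator_iff:
  assumes "compatible R \<alpha>" "a \<in> carrier R" "b \<in> carrier R"
  shows "a \<otimes> (\<alpha> ^^ i) b = \<zero> \<longleftrightarrow> a \<otimes> b = \<zero>"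
proof (induction i)
  case (Suc i)
  have "a \<otimes> (\<alpha> ^^ Suc i) b = \<zero> \<longleftrightarrow> a \<otimes> (\<alpha> ^^ i) b = \<zero>"
    using assms endo_closed[of b i] unfolding compatible_def by simp
  then show ?case using Suc.IH by simp
qed simp

lemma rigidD: "\<lbrakk>rigid R \<alpha>; a \<in> carrier R; a \<otimes> \<alpha> a = \<zero>\<rbrakk> \<Longrightarrow> a = \<zero>"
  unfolding rigid_def by blast

text \<open>Let a^2 = 0 and u = a \<alpha>(a). Then u \<alpha>(u) contains \<alpha>(a)^2 =
  \<alpha>(a^2) = 0, so rigidity kills first u and then a.\<close>

lemma rigid_imp_reduced:
  assumes "rigid R \<alpha>"
  shows "reduced_ring R"
proof (rule reduced_ringI[OF ring_axioms])
  fix a assume a: "a \<in> carrier R" "a \<otimes> a = \<zero>"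
  have "\<alpha> a \<otimes> \<alpha> a = \<zero>"
    using a ring_hom_mult[OF hom, of a a] endo_zero[of 1] by simp
  then have "a \<otimes> (\<alpha> a \<otimes> \<alpha> a) \<otimes> \<alpha> (\<alpha> a) = \<zero>"
    using a by (simp add: hom_rules)
  then have "a \<otimes> \<alpha> a \<otimes> \<alpha> (a \<otimes> \<alpha> a) = \<zero>"
    using a(1) by (simp add: hom_rules m_assoc)
  then have "a \<otimes> \<alpha> a = \<zero>"
    using a(1) by (intro rigidD[OF assms, of "a \<otimes> \<alpha> a"]) (simp_all add: hom_rules(1))
  then show "a = \<zero>"
    using rigidD[OF assms a(1)] by simp
qed

text \<open>Rigidity is applied to u = a \<alpha>(b) in one direction and to u = ba in the other. In
  the first, u \<alpha>(u) contains \<alpha>(b) \<alpha>(a) = \<alpha>(ba), zero by reducedness; in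
  the second it contains a \<alpha>(b).\<close>

lemma rigid_imp_compatible:
  assumes rigid: "rigid R \<alpha>"
  shows "compatible R \<alpha>"
proof -
  interpret reduced_ring R by (rule rigid_imp_reduced[OF rigid])
  show ?thesis
    unfolding compatible_def
  proof (intro ballI iffI)
    fix a b assume ab: "a \<in> carrier R" "b \<in> carrier R"
    {
      assume "a \<otimes> b = \<zero>"
      then have "\<alpha> b \<otimes> \<alpha> a = \<zero>"
        using ab mult_zero_swap[of a b] ring_hom_mult[OF hom, of b a] endo_zero[of 1] by simp
      then have "a \<otimes> (\<alpha> b \<otimes> \<alpha> a) \<otimes> \<alpha> (\<alpha> b) = \<zero>"
        using ab by (simp add: hom_rules)
      then have "a \<otimes> \<alpha> b \<otimes> \<alpha> (a \<otimes> \<alpha> b) = \<zero>"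
        using ab by (simp add: hom_rules m_assoc)
      then show "a \<otimes> \<alpha> b = \<zero>"
        using ab by (intro rigidD[OF rigid, of "a \<otimes> \<alpha> b"]) (simp_all add: hom_rules(1))
    next
      assume "a \<otimes> \<alpha> b = \<zero>"
      then have "b \<otimes> (a \<otimes> \<alpha> b) \<otimes> \<alpha> a = \<zero>"
        using ab by (simp add: hom_rules)
      then have "b \<otimes> a \<otimes> \<alpha> (b \<otimes> a) = \<zero>"
        using ab by (simp add: hom_rules m_assoc)
      then have "b \<otimes> a = \<zero>"
        using rigidD[OF rigid, of "b \<otimes> a"] ab by simp
      then show "a \<otimes> b = \<zero>"
        using ab mult_zero_swap by blast
    }
  qed
qed

text \<open>This is the equivalence of (ii) and (iii). For the converse, compatibility turns a
  \<alpha>(a) = 0 into a^2 = 0.\<close>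

lemma rigid_iff: "rigid R \<alpha> \<longleftrightarrow> reduced_ring R \<and> compatible R \<alpha>"
proof (intro iffI conjI)
  assume "reduced_ring R \<and> compatible R \<alpha>"
  then have red: "reduced_ring R" and comp: "compatible R \<alpha>" by auto
  show "rigid R \<alpha>"
    unfolding rigid_def
  proof (intro ballI impI)
    fix a assume "a \<in> carrier R" "a \<otimes> \<alpha> a = \<zero>"
    moreover from this comp have "a \<otimes> a = \<zero>" unfolding compatible_def by blast
    ultimately show "a = \<zero>" using reduced_ring.square_zeroD[OF red] by blast
  qed
qed (auto intro: rigid_imp_reduced rigid_imp_compatible)

section \<open>Ascent from the coefficient ring to the series ring\<close>

text \<open>If f^2 = 0 and all coefficients of f below degree n vanish, the coefficient of degree 2n
  in f^2 reduces to f_n \<alpha>^n(f_n), so f_n^2 = 0 by compatibility.\<close>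

lemma series_reduced:
  assumes "reduced_ring R" "compatible R \<alpha>"
  shows "reduced_ring S"
proof (rule reduced_ringI[OF ring_series])
  interpret reduced_ring R by fact
  fix f assume f: "f \<in> carrier S" "f \<otimes>\<^bsub>S\<^esub> f = \<zero>\<^bsub>S\<^esub>"
  note [simp] = coeff_closed[OF f(1)]
  have "f n = \<zero>" for n
  proof (induction n rule: less_induct)
    case (less n)
    have "(f \<otimes>\<^bsub>S\<^esub> f) (n + n) = f n \<otimes> (\<alpha> ^^ n) (f (n + n - n))"
      unfolding coeff_mult
    proof (rule finsum_eq_single)
      fix i assume "i \<in> {..n + n}" "i \<noteq> n"
      then have "i < n \<or> n + n - i < n" by auto
      then show "f i \<otimes> (\<alpha> ^^ i) (f (n + n - i)) = \<zero>"
        using less.IH by auto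
    qed auto
    then have "f n \<otimes> (\<alpha> ^^ n) (f n) = \<zero>"
      using f(2) by (simp add: coeff_zero)
    then have "f n \<otimes> f n = \<zero>"
      using endo_annihilator_iff[OF assms(2)] by simp
    then show "f n = \<zero>" by (rule square_zeroD[rotated]) simp
  qed
  then show "f = \<zero>\<^bsub>S\<^esub>" by (simp add: fun_eq_iff coeff_zero)
qed

text \<open>Each of these coefficients is a sum of twisted products having \<open>f 0\<close> among the factors.\<close>

lemma annihilates_low_coeffs_pow:
  assumes "reduced_ring R" "compatible R \<alpha>" "f \<in> carrier S" "r \<in> carrier R" "r \<otimes> f 0 = \<zero>"
  shows "j < n \<Longrightarrow> r \<otimes> (f [^]\<^bsub>S\<^esub> n) j = \<zero>"
proof (induction n arbitrary: j)
  case (Suc n)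
  interpret reduced_ring R by fact
  define F where "F = f [^]\<^bsub>S\<^esub> n"
  have F: "F \<in> carrier S" using assms(3) by (simp add: F_def)
  note [simp] = coeff_closed[OF assms(3)] coeff_closed[OF F] assms(4)
  have zero: "r \<otimes> (F i \<otimes> (\<alpha> ^^ i) (f (j - i))) = \<zero>" if "i \<le> j" for i
  proof (cases "i < n")
    case True
    then have "r \<otimes> F i = \<zero>" unfolding F_def by (rule Suc.IH)
    then show ?thesis by (simp add: m_assoc[symmetric])
  next
    case False
    \<comment> \<open>Here i = j = n, so the right factor is a twist of \<open>f 0\<close>, which
      \<open>r\<close> annihilates by compatibility.\<close>
    then have "j - i = 0" using that Suc.prems by simp
    have "r \<otimes> (\<alpha> ^^ i) (f 0) = \<zero>"
      using endo_annihilator_iff[OF assms(2)] assms(5) by simp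
    then have "r \<otimes> F i \<otimes> (\<alpha> ^^ i) (f 0) = \<zero>"
      by (intro mult_zero_insert) auto
    then show ?thesis using \<open>j - i = 0\<close> by (simp add: m_assoc)
  qed
  have "r \<otimes> (F \<otimes>\<^bsub>S\<^esub> f) j = (\<Oplus>i\<in>{..j}. r \<otimes> (F i \<otimes> (\<alpha> ^^ i) (f (j - i))))"
    unfolding coeff_mult by (intro finsum_rdistr) auto
  also have "\<dots> = (\<Oplus>i\<in>{..j}. \<zero>)"
    using zero by (intro finsum_cong') auto
  finally show ?case by (simp add: F_def)
qed simp

text \<open>Multiplying by \<alpha>^k(a) kills every term of the convolution except the last: for i
  < k compatibility gives h_i \<alpha>^k(a) = 0, and the coefficient of F may be inserted in
  between.\<close>

lemma mult_coeff_mult_endo: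
  assumes "reduced_ring R" "compatible R \<alpha>" "h \<in> carrier S" "F \<in> carrier S" "a \<in> carrier R"
    and ann: "\<And>l. l < k \<Longrightarrow> h l \<otimes> a = \<zero>"
  shows "(h \<otimes>\<^bsub>S\<^esub> F) k \<otimes> (\<alpha> ^^ k) a = h k \<otimes> (\<alpha> ^^ k) (F 0 \<otimes> a)"
proof -
  interpret reduced_ring R by fact
  note [simp] = coeff_closed[OF assms(3)] coeff_closed[OF assms(4)] assms(5)
  have "(h \<otimes>\<^bsub>S\<^esub> F) k \<otimes> (\<alpha> ^^ k) a
      = (\<Oplus>i\<in>{..k}. h i \<otimes> (\<alpha> ^^ i) (F (k - i)) \<otimes> (\<alpha> ^^ k) a)"
    unfolding coeff_mult by (intro finsum_ldistr) auto
  also have "\<dots> = h k \<otimes> (\<alpha> ^^ k) (F (k - k)) \<otimes> (\<alpha> ^^ k) a"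
  proof (rule finsum_eq_single)
    fix i assume "i \<in> {..k}" "i \<noteq> k"
    then have "h i \<otimes> (\<alpha> ^^ k) a = \<zero>"
      using ann endo_annihilator_iff[OF assms(2)] by simp
    then show "h i \<otimes> (\<alpha> ^^ i) (F (k - i)) \<otimes> (\<alpha> ^^ k) a = \<zero>"
      by (intro mult_zero_insert) auto
  qed auto
  finally show ?thesis by (simp add: endo_mult m_assoc)
qed

lemma endo_nonunit:
  assumes "preserves_nonunits R \<alpha>" "a \<in> carrier R - Units R"
  shows "(\<alpha> ^^ i) a \<in> carrier R - Units R"
proof (induction i)
  case (Suc i)
  then have "\<alpha> ((\<alpha> ^^ i) a) \<in> carrier R - Units R"
    using assms(1) unfolding preserves_nonunits_def by blast
  then show ?case by simp
qed (use assms(2) in simp)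

text \<open>
  For \<open>g = h f\<^sup>n\<close> with \<open>a = f 0\<close>, induction on \<open>k\<close> gives \<open>h k \<otimes> a = \<zero>\<close>: as the earlier coefficients
  of \<open>h\<close> annihilate \<open>a\<close>, one has \<open>g k \<otimes> \<alpha>\<^sup>k a = h k \<otimes> (\<alpha>\<^sup>k a)\<^sup>n\<^sup>+\<^sup>1\<close> for every \<open>n\<close>, and \<open>\<alpha>\<^sup>k a\<close> is a nonunit.
  Taking \<open>n > k\<close>, every term of \<open>g k\<close> then vanishes.
\<close>

lemma series_right_archimedean:
  assumes arch: "right_archimedean_ring R" and red: "reduced_ring R"
    and comp: "compatible R \<alpha>" and pres: "preserves_nonunits R \<alpha>"
  shows "right_archimedean_ring S"
  unfolding right_archimedean_ring_iff[OF ring_series]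
proof (intro ballI impI)
  interpret reduced_ring R by fact
  fix f g
  assume f: "f \<in> carrier S - Units S" and g: "g \<in> carrier S"
    and div: "\<forall>n\<ge>1. \<exists>h\<in>carrier S. g = h \<otimes>\<^bsub>S\<^esub> f [^]\<^bsub>S\<^esub> (n::nat)"
  define a where "a = f 0"
  have fS: "f \<in> carrier S" using f by simp
  have pow_closed [simp]: "f [^]\<^bsub>S\<^esub> (n::nat) \<in> carrier S" for n
    using fS by simp
  have a: "a \<in> carrier R - Units R"
    using f series_Units_iff[of f] coeff_closed[of f 0] by (auto simp: a_def)
  have aR [simp]: "a \<in> carrier R" using a by simp
  have ann: "h k \<otimes> a = \<zero>"
    if "n \<ge> 1" "h \<in> carrier S" "g = h \<otimes>\<^bsub>S\<^esub> f [^]\<^bsub>S\<^esub> n" for h k and n :: nat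
    using that
  proof (induction k arbitrary: h n rule: less_induct)
    case (less k)
    define b where "b = (\<alpha> ^^ k) a"
    have b: "b \<in> carrier R - Units R"
      unfolding b_def by (rule endo_nonunit[OF pres a])
    \<comment> \<open>Needed for every exponent \<open>n\<close> and every quotient
      \<open>h\<close>, hence the induction with both arbitrary: one fixed left side is thereby
      divisible by all powers of \<open>b\<close>.\<close>
    have eq: "g k \<otimes> b = h k \<otimes> b [^] Suc n"
      if "n \<ge> 1" "h \<in> carrier S" "g = h \<otimes>\<^bsub>S\<^esub> f [^]\<^bsub>S\<^esub> n" for h and n :: nat
    proof -
      have "g k \<otimes> b = h k \<otimes> (\<alpha> ^^ k) ((f [^]\<^bsub>S\<^esub> n) 0 \<otimes> a)"
        unfolding b_def that(3)
        using that less.IH[OF _ that]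
        by (intro mult_coeff_mult_endo[OF red comp]) auto
      also have "\<dots> = h k \<otimes> (\<alpha> ^^ k) (a [^] Suc n)"
        using coeff_0_pow[OF fS] by (simp add: a_def)
      finally show ?thesis by (simp only: endo_pow[OF aR] b_def)
    qed
    have "\<exists>c\<in>carrier R. g k \<otimes> b = c \<otimes> b [^] n" if "n \<ge> 1" for n :: nat
    proof -
      obtain h where h: "h \<in> carrier S" "g = h \<otimes>\<^bsub>S\<^esub> f [^]\<^bsub>S\<^esub> n"
        using div \<open>n \<ge> 1\<close> by blast
      have "g k \<otimes> b = h k \<otimes> b [^] Suc n" by (rule eq[OF that h])
      also have "\<dots> = h k \<otimes> b \<otimes> b [^] n"
        using b coeff_closed[OF h(1)] nat_pow_mult[of b 1 n] by (simp add: m_assoc)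
      finally show ?thesis using b coeff_closed[OF h(1)] by blast
    qed
    then have "g k \<otimes> b = \<zero>"
      using arch b coeff_closed[OF g] unfolding right_archimedean_ring_iff[OF ring_axioms] by blast
    then have "h k \<otimes> b [^] Suc n = \<zero>"
      using eq[OF less.prems] by simp
    \<comment> \<open>Reducedness strips the power; compatibility then removes the twist hidden in
      \<open>b\<close>.\<close>
    then have "h k \<otimes> b = \<zero>"
      using b coeff_closed[OF less.prems(2)] mult_pow_zeroD[of "h k" b n] by blast
    then show ?case
      using endo_annihilator_iff[OF comp] coeff_closed[OF less.prems(2)] by (simp add: b_def)
  qed
  have "g k = \<zero>" for k
  proof -
    obtain h where h: "h \<in> carrier S" "g = h \<otimes>\<^bsub>S\<^esub> f [^]\<^bsub>S\<^esub> Suc k"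
      using div by (metis le_add1 plus_1_eq_Suc)
    note [simp] = coeff_closed[OF h(1)] coeff_closed[OF pow_closed]
    have "h i \<otimes> (\<alpha> ^^ i) ((f [^]\<^bsub>S\<^esub> Suc k) (k - i)) = \<zero>" for i
    proof -
      have "h i \<otimes> f 0 = \<zero>" using ann[OF _ h] by (simp add: a_def)
      then have "h i \<otimes> (f [^]\<^bsub>S\<^esub> Suc k) (k - i) = \<zero>"
        by (intro annihilates_low_coeffs_pow[OF red comp fS]) auto
      then show ?thesis
        using endo_annihilator_iff[OF comp coeff_closed[OF h(1)] coeff_closed[OF pow_closed]] by blast
    qed
    then have "g k = (\<Oplus>i\<in>{..k}. \<zero>)"
      unfolding h(2) coeff_mult by (intro finsum_cong') auto
    then show ?thesis by simp
  qed
  then show "g = \<zero>\<^bsub>S\<^esub>" by (simp add: fun_eq_iff coeff_zero)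
qed

section \<open>Descent from the series ring to the coefficient ring\<close>

text \<open>If a \<alpha>(a) = 0, then \<open>a x\<close> has square zero.\<close>

lemma rigid_of_series_reduced:
  assumes "reduced_ring S"
  shows "rigid R \<alpha>"
  unfolding rigid_def
proof (intro ballI impI)
  fix a assume a: "a \<in> carrier R" "a \<otimes> \<alpha> a = \<zero>"
  have "monom a 1 \<otimes>\<^bsub>S\<^esub> monom a 1 = \<zero>\<^bsub>S\<^esub>"
    using a monom_mult_monom[of a a 1 1] unfolding zero_eq_monom[of "1 + 1"] by simp
  then have "monom a 1 = \<zero>\<^bsub>S\<^esub>"
    by (rule reduced_ring.square_zeroD[OF assms monom_closed[OF a(1)]])
  then show "a = \<zero>" unfolding zero_eq_monom[of 1] by simp
qed

lemma monom_nonunit: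
  assumes "a \<in> carrier R - Units R"
  shows "monom a 0 \<in> carrier S - Units S"
proof -
  have "monom a 0 0 = a" by (simp add: monom_def)
  then show ?thesis using assms series_Units_iff[of "monom a 0"] by auto
qed

text \<open>Constant series form a copy of R in which nonunits remain nonunits of the larger ring,
  and divisibility in R gives divisibility there.\<close>

lemma right_archimedean_of_series:
  assumes "right_archimedean_ring S"
  shows "right_archimedean_ring R"
  unfolding right_archimedean_ring_iff[OF ring_axioms]
proof (intro ballI impI)
  fix a b
  assume a: "a \<in> carrier R - Units R" and b: "b \<in> carrier R"
    and div: "\<forall>n\<ge>1. \<exists>c\<in>carrier R. b = c \<otimes> a [^] (n::nat)"
  have "\<exists>h\<in>carrier S. monom b 0 = h \<otimes>\<^bsub>S\<^esub> monom a 0 [^]\<^bsub>S\<^esub> n" if "n \<ge> 1" for n :: nat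
  proof -
    obtain c where c: "c \<in> carrier R" "b = c \<otimes> a [^] n"
      using div \<open>n \<ge> 1\<close> by blast
    then have "monom b 0 = monom c 0 \<otimes>\<^bsub>S\<^esub> monom a 0 [^]\<^bsub>S\<^esub> n"
      using a by (simp add: monom_0_pow monom_mult_monom)
    then show ?thesis using c(1) monom_closed by blast
  qed
  then have "monom b 0 = \<zero>\<^bsub>S\<^esub>"
    using assms monom_nonunit[OF a] monom_closed[OF b]
    unfolding right_archimedean_ring_iff[OF ring_series] by blast
  then show "b = \<zero>" unfolding zero_eq_monom[of 0] by simp
qed

text \<open>If \<open>\<alpha> a\<close> is a unit, then \<open>x = (\<alpha> a)\<^sup>-\<^sup>n x a\<^sup>n\<close> for every \<open>n\<close>.\<close>

lemma preserves_nonunits_of_series: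
  assumes "right_archimedean_ring S"
  shows "preserves_nonunits R \<alpha>"
proof -
  have "\<alpha> a \<notin> Units R" if a: "a \<in> carrier R - Units R" for a
  proof
    assume unit: "\<alpha> a \<in> Units R"
    have aR: "a \<in> carrier R" using a by simp
    have "\<exists>h\<in>carrier S. monom \<one> 1 = h \<otimes>\<^bsub>S\<^esub> monom a 0 [^]\<^bsub>S\<^esub> n" for n :: nat
    proof -
      have u: "\<alpha> a [^] n \<in> Units R"
        using unit by (induction n) auto
      then have "monom \<one> 1 = monom (inv (\<alpha> a [^] n)) 1 \<otimes>\<^bsub>S\<^esub> monom a 0 [^]\<^bsub>S\<^esub> n"
        using aR endo_pow[of a 1 n] by (simp add: monom_0_pow monom_mult_monom)
      then show ?thesis using u monom_closed by blast
    qed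
    then have "monom \<one> 1 = \<zero>\<^bsub>S\<^esub>"
      using assms monom_nonunit[OF a] monom_closed[OF one_closed]
      unfolding right_archimedean_ring_iff[OF ring_series] by blast
    \<comment> \<open>The vanishing of x forces R to be the zero ring, in which every element is a
      unit, contrary to the choice of \<open>a\<close>.\<close>
    then have "\<one> = \<zero>" unfolding zero_eq_monom[of 1] by simp
    then have "a = \<one>" using aR one_zeroD by fastforce
    then show False using a by simp
  qed
  then show ?thesis
    unfolding preserves_nonunits_def using hom_rules by blast
qed

end

theorem theorem4p4:
  fixes R :: "('a, 'm) ring_scheme" and \<alpha> :: "'a \<Rightarrow> 'a"
  assumes "ring R" and "\<alpha> \<in> ring_hom R R"
  shows
    "(reduced_ring (skew_power_series R \<alpha>) \<and> right_archimedean_ring (skew_power_series R \<alpha>)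
        \<longleftrightarrow> right_archimedean_ring R \<and> rigid R \<alpha> \<and> preserves_nonunits R \<alpha>) \<and>
     (right_archimedean_ring R \<and> rigid R \<alpha> \<and> preserves_nonunits R \<alpha>
        \<longleftrightarrow> reduced_ring R \<and> right_archimedean_ring R \<and> compatible R \<alpha> \<and>
            preserves_nonunits R \<alpha>)"
proof -
  interpret skew_ring R \<alpha>
    using assms by (simp add: skew_ring_def skew_ring_axioms_def)
  show ?thesis
    using rigid_iff series_reduced series_right_archimedean rigid_of_series_reduced
      right_archimedean_of_series preserves_nonunits_of_series by blast
qed

end
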